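(* Let $X(t,z)$ be an orthogonal parametrization of a surface $M$ in $\mathbb{R}^3$, with coefficients of the first fundamental form $E$, $F=0$, $G$, coefficients of the second fundamental form $e,f,g$, and Christoffel symbols $\Gamma_{ij}^k$. Let $\gamma(s)=X(t(s),z(s))$ be an arc-length parametrized curve in $M$. Then $\gamma$ is a pseudo-geodesic line in $M$ whose constant angle $\theta$ satisfies $\cos\theta\neq0$ if and only if there is a constant $\theta$ with $\cos\theta\neq 0$ such that $$t''+(t')^2\left(\Gamma_{11}^1+\tan\theta\,z'\sqrt{G/E}\,e\right)+2t'z'\left(\Gamma_{12}^1+\tan\theta\,z'\sqrt{G/E}\,f\right)+(z')^2\left(\Gamma_{22}^1+\tan\theta\,z'\sqrt{G/E}\,g\right)=0,$$ $$z''+(t')^2\left(\Gamma_{11}^2-\tan\theta\,t'\sqrt{E/G}\,e\right)+2t'z'\left(\Gamma_{12}^2-\tan\theta\,t'\sqrt{E/G}\,f\right)+(z')^2\left(\Gamma_{22}^2-\tan\theta\,t'\sqrt{E/G}\,g\right)=0,$$ where all coefficients are evaluated at $(t(s),z(s))$.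
   Context: $M$ is a smooth regular orientable connected surface in $\mathbb{R}^3$ with Gauss map $N$; the parametrization is positively oriented, i.e. $N=X_t\times X_z/|X_t\times X_z|$. The coefficients are $E=\langle X_t,X_t\rangle$, $F=\langle X_t,X_z\rangle=0$, $G=\langle X_z,X_z\rangle$, $e=\langle X_{tt},N\rangle$, $f=\langle X_{tz},N\rangle$, $g=\langle X_{zz},N\rangle$, and indices $1,2$ of the Christoffel symbols refer to $t,z$. Arc-length parametrized curves are assumed to have curvature $\kappa_\gamma>0$, so that the unit tangent $T_\gamma$ and principal normal $N_\gamma$ are defined. A curve $\gamma$ in $M$ is a pseudo-geodesic line if the angle $\theta$ between $N_\gamma$ and $N$ is constant along $\gamma$, where $N_\gamma=\sin\theta\,(N\times T_\gamma)+\cos\theta\,N$. *)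

theory Defs
  imports "HOL-Analysis.Analysis"
begin

(* Class C^n, used on open sets only: all iterated derivatives along the standard basis,
   up to order n, exist as Frechet derivatives and are continuous. *)
primrec Ck_on :: "nat \<Rightarrow> 'a::euclidean_space set \<Rightarrow> ('a \<Rightarrow> 'b::real_normed_vector) \<Rightarrow> bool" where
  "Ck_on 0 S f \<longleftrightarrow> continuous_on S f"
| "Ck_on (Suc n) S f \<longleftrightarrow>
     (\<forall>x\<in>S. f differentiable (at x)) \<and>
     (\<forall>b\<in>Basis. Ck_on n S (\<lambda>x. frechet_derivative f (at x) b))"

definition smooth_on :: "'a::euclidean_space set \<Rightarrow> ('a \<Rightarrow> 'b::real_normed_vector) \<Rightarrow> bool" where
  "smooth_on S f \<longleftrightarrow> (\<forall>n. Ck_on n S f)"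

(* Coordinate indices have the two-element type 2: index 1 is the first variable t,
   index 2 (= 0 in this type) is the second variable z. *)
definition coord_vec :: "2 \<Rightarrow> real \<times> real" where
  "coord_vec i = (if i = 1 then (1, 0) else (0, 1))"

definition partial :: "2 \<Rightarrow> (real \<times> real \<Rightarrow> 'b::real_normed_vector) \<Rightarrow> real \<times> real \<Rightarrow> 'b" where
  "partial i f p = frechet_derivative f (at p) (coord_vec i)"

(* X need be neither injective nor onto M, so that e.g. full turns around a surface of
   revolution are allowed. *)
definition regular_parametrization ::
  "(real^3) set \<Rightarrow> (real \<times> real) set \<Rightarrow> (real \<times> real \<Rightarrow> real^3) \<Rightarrow> bool" where
  "regular_parametrization M U X \<longleftrightarrow>
     open U \<and> smooth_on U X \<and> X ` U \<subseteq> M \<and>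
     (\<forall>p\<in>U. cross3 (partial 1 X p) (partial 2 X p) \<noteq> 0)"

definition surface_chart ::
  "(real^3) set \<Rightarrow> (real \<times> real) set \<Rightarrow> (real \<times> real \<Rightarrow> real^3) \<Rightarrow> bool" where
  "surface_chart M U X \<longleftrightarrow>
     regular_parametrization M U X \<and> openin (top_of_set M) (X ` U) \<and>
     (\<exists>Y. homeomorphism U (X ` U) X Y)"

definition regular_surface :: "(real^3) set \<Rightarrow> bool" where
  "regular_surface M \<longleftrightarrow> (\<forall>q\<in>M. \<exists>U X. surface_chart M U X \<and> q \<in> X ` U)"

(* A surface is orientable iff it has a Gauss map; the tangent plane at X p is spanned by
   the partial derivatives of a chart X at p. *)
definition gauss_map :: "(real^3) set \<Rightarrow> (real^3 \<Rightarrow> real^3) \<Rightarrow> bool" where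
  "gauss_map M N \<longleftrightarrow>
     (\<forall>q\<in>M. norm (N q) = 1) \<and>
     (\<forall>U X. surface_chart M U X \<longrightarrow>
        smooth_on U (N \<circ> X) \<and>
        (\<forall>p\<in>U. \<forall>i. N (X p) \<bullet> partial i X p = 0))"

definition positively_oriented ::
  "(real^3 \<Rightarrow> real^3) \<Rightarrow> (real \<times> real) set \<Rightarrow> (real \<times> real \<Rightarrow> real^3) \<Rightarrow> bool" where
  "positively_oriented N U X \<longleftrightarrow>
     (\<forall>p\<in>U. N (X p) = cross3 (partial 1 X p) (partial 2 X p)
                        /\<^sub>R norm (cross3 (partial 1 X p) (partial 2 X p)))"

definition first_form :: "(real \<times> real \<Rightarrow> real^3) \<Rightarrow> 2 \<Rightarrow> 2 \<Rightarrow> real \<times> real \<Rightarrow> real" where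
  "first_form X i j p = partial i X p \<bullet> partial j X p"

definition second_form ::
  "(real^3 \<Rightarrow> real^3) \<Rightarrow> (real \<times> real \<Rightarrow> real^3) \<Rightarrow> 2 \<Rightarrow> 2 \<Rightarrow> real \<times> real \<Rightarrow> real" where
  "second_form N X i j p = partial j (partial i X) p \<bullet> N (X p)"

definition inverse_first_form ::
  "(real \<times> real \<Rightarrow> real^3) \<Rightarrow> 2 \<Rightarrow> 2 \<Rightarrow> real \<times> real \<Rightarrow> real" where
  "inverse_first_form X k l p = matrix_inv (\<chi> i j. first_form X i j p) $ k $ l"

(* christoffel X i j k is the symbol with lower indices i, j and upper index k. *)
definition christoffel ::
  "(real \<times> real \<Rightarrow> real^3) \<Rightarrow> 2 \<Rightarrow> 2 \<Rightarrow> 2 \<Rightarrow> real \<times> real \<Rightarrow> real" where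
  "christoffel X i j k p =
     (\<Sum>l\<in>UNIV. inverse_first_form X k l p *
        (partial i (first_form X j l) p + partial j (first_form X i l) p
           - partial l (first_form X i j) p)) / 2"

(* The next three notions are meant for curves parametrized by arc length. *)
definition unit_tangent :: "(real \<Rightarrow> real^3) \<Rightarrow> real \<Rightarrow> real^3" where
  "unit_tangent \<gamma> s = vector_derivative \<gamma> (at s)"

definition curvature :: "(real \<Rightarrow> real^3) \<Rightarrow> real \<Rightarrow> real" where
  "curvature \<gamma> s = norm (vector_derivative (unit_tangent \<gamma>) (at s))"

definition principal_normal :: "(real \<Rightarrow> real^3) \<Rightarrow> real \<Rightarrow> real^3" where
  "principal_normal \<gamma> s = vector_derivative (unit_tangent \<gamma>) (at s) /\<^sub>R curvature \<gamma> s"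

definition arc_length_curve :: "real set \<Rightarrow> (real \<Rightarrow> real^3) \<Rightarrow> bool" where
  "arc_length_curve I \<gamma> \<longleftrightarrow>
     open I \<and> is_interval I \<and> I \<noteq> {} \<and> smooth_on I \<gamma> \<and>
     (\<forall>s\<in>I. norm (unit_tangent \<gamma> s) = 1 \<and> curvature \<gamma> s > 0)"

(* The oriented angle from N to the principal normal, measured in the plane normal to the
   curve towards N x T, is the constant theta (determined modulo 2 pi). *)
definition pseudo_geodesic ::
  "(real^3) set \<Rightarrow> (real^3 \<Rightarrow> real^3) \<Rightarrow> real set \<Rightarrow> (real \<Rightarrow> real^3) \<Rightarrow> real \<Rightarrow> bool" where
  "pseudo_geodesic M N I \<gamma> \<theta> \<longleftrightarrow>
     \<gamma> ` I \<subseteq> M \<and>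
     (\<forall>s\<in>I. principal_normal \<gamma> s =
        sin \<theta> *\<^sub>R cross3 (N (\<gamma> s)) (unit_tangent \<gamma> s) + cos \<theta> *\<^sub>R N (\<gamma> s))"

end

theory Submission
  imports Defs
begin

text \<open>Write \<open>n\<close>, \<open>T\<close> for the surface normal and the unit tangent along the curve, and
  \<open>L = \<gamma>'' \<bullet> n\<close> for the normal curvature. For an orthogonal parametrization, the two differential
  equations are the \<open>X\<^sub>t\<close> and \<open>X\<^sub>z\<close> components of \<open>\<gamma>'' = L (n + tan \<theta> (n \<times> T))\<close>, whose
  normal component is trivial. This vector equation says that \<open>\<gamma>''\<close> is the multiple \<open>L / cos \<theta>\<close> of the
  unit vector \<open>sin \<theta> (n \<times> T) + cos \<theta> n\<close>. As the curvature does not vanish, \<open>L / cos \<theta>\<close> has constant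
  sign on the interval; if it is negative, the angle of the pseudo-geodesic is \<open>\<theta> + \<pi>\<close> instead of
  \<open>\<theta>\<close>, which has the same tangent.\<close>

section \<open>Calculus of smooth functions on open sets\<close>

text \<open>On an open set derivatives depend only on nearby values, so agreement on
  \<open>S\<close> passes to every order by induction. It is used to replace
  \<open>frechet_derivative c (at s) 1\<close> by \<open>vector_derivative c (at s)\<close>, an
  equality obtained only at points where \<open>c\<close> is differentiable.\<close>

lemma Ck_on_cong:
  assumes "open S" "\<And>x. x \<in> S \<Longrightarrow> f x = g x"
  shows "Ck_on n S f \<longleftrightarrow> Ck_on n S g"
  using assms(2)
proof (induction n arbitrary: f g)
  case 0
  then show ?case by (simp cong: continuous_on_cong)
next
  case (Suc n)
  have diff: "f differentiable (at x) \<longleftrightarrow> g differentiable (at x)" if "x \<in> S" for x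
    using that Suc.prems \<open>open S\<close>
    by (metis differentiable_def has_derivative_transform_within_open)
  have "Ck_on n S (\<lambda>x. frechet_derivative f (at x) b) \<longleftrightarrow> Ck_on n S (\<lambda>x. frechet_derivative g (at x) b)"
    if "\<forall>x\<in>S. f differentiable (at x)" for b
  proof (rule Suc.IH)
    fix x assume "x \<in> S"
    then have "frechet_derivative f (at x) = frechet_derivative g (at x)"
      using frechet_derivative_transform_within_open that \<open>open S\<close> Suc.prems by blast
    then show "frechet_derivative f (at x) b = frechet_derivative g (at x) b" by simp
  qed
  then show ?case using diff by auto
qed

lemma smooth_on_continuous_on: "smooth_on S f \<Longrightarrow> continuous_on S f"
  unfolding smooth_on_def by (metis Ck_on.simps(1))

lemma smooth_on_differentiable: "smooth_on S f \<Longrightarrow> x \<in> S \<Longrightarrow> f differentiable (at x)"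
  unfolding smooth_on_def by (metis Ck_on.simps(2))

lemma smooth_on_frechet_derivative:
  "smooth_on S f \<Longrightarrow> b \<in> Basis \<Longrightarrow> smooth_on S (\<lambda>x. frechet_derivative f (at x) b)"
  unfolding smooth_on_def by (metis Ck_on.simps(2))

lemma smooth_on_partial:
  fixes X :: "real \<times> real \<Rightarrow> 'b::real_normed_vector"
  assumes "smooth_on U X"
  shows "smooth_on U (partial i X)"
proof -
  have "coord_vec i \<in> Basis"
    by (auto simp: coord_vec_def Basis_prod_def)
  from smooth_on_frechet_derivative[OF assms this] show ?thesis
    by (simp add: partial_def[abs_def])
qed

text \<open>A linear map on the plane is determined by its values on the two coordinate vectors,
  which for the derivative are the partial derivatives.\<close>

lemma smooth_on_has_derivative:
  fixes X :: "real \<times> real \<Rightarrow> 'b::real_normed_vector"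
  assumes "smooth_on U X" "p \<in> U"
  shows "(X has_derivative (\<lambda>(u, v). u *\<^sub>R partial 1 X p + v *\<^sub>R partial 2 X p)) (at p)"
proof -
  have d: "(X has_derivative frechet_derivative X (at p)) (at p)"
    using smooth_on_differentiable[OF assms] frechet_derivative_works by blast
  then interpret bounded_linear "frechet_derivative X (at p)"
    by (rule has_derivative_bounded_linear)
  have "frechet_derivative X (at p) w = fst w *\<^sub>R partial 1 X p + snd w *\<^sub>R partial 2 X p" for w
  proof -
    have "w = fst w *\<^sub>R (1, 0) + snd w *\<^sub>R (0, 1)" by (simp add: prod_eq_iff)
    then have "frechet_derivative X (at p) w
        = frechet_derivative X (at p) (fst w *\<^sub>R (1, 0) + snd w *\<^sub>R (0, 1))" by simp
    then show ?thesis by (simp only: add scaleR) (simp add: partial_def coord_vec_def)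
  qed
  then have "frechet_derivative X (at p) = (\<lambda>(u, v). u *\<^sub>R partial 1 X p + v *\<^sub>R partial 2 X p)"
    by (auto simp: fun_eq_iff)
  with d show ?thesis by simp
qed

lemma partial_eqI:
  assumes "(f has_derivative f') (at p)"
  shows "partial i f p = f' (coord_vec i)"
  using frechet_derivative_at[OF assms] by (simp add: partial_def)

lemma smooth_on_has_vector_derivative:
  assumes "smooth_on I c" "s \<in> I"
  shows "(c has_vector_derivative vector_derivative c (at s)) (at s)"
  using smooth_on_differentiable[OF assms] vector_derivative_works by metis

lemma smooth_on_vector_derivative:
  fixes c :: "real \<Rightarrow> 'b::real_normed_vector"
  assumes "smooth_on I c" "open I"
  shows "smooth_on I (\<lambda>s. vector_derivative c (at s))"
proof -
  have "frechet_derivative c (at s) 1 = vector_derivative c (at s)" if "s \<in> I" for s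
    using frechet_derivative_eq_vector_derivative[OF smooth_on_differentiable[OF assms(1) that]]
    by simp
  then show ?thesis
    using smooth_on_frechet_derivative[OF assms(1), of 1] Ck_on_cong[OF \<open>open I\<close>]
    unfolding smooth_on_def by (metis (no_types, lifting) Basis_real_def singletonI)
qed

lemma smooth_on_has_real_derivative:
  fixes c :: "real \<Rightarrow> real"
  assumes "smooth_on I c" "s \<in> I"
  shows "(c has_real_derivative deriv c s) (at s)"
  using smooth_on_has_vector_derivative[OF assms]
  by (metis DERIV_imp_deriv has_real_derivative_iff_has_vector_derivative)

lemma smooth_on_deriv:
  fixes c :: "real \<Rightarrow> real"
  assumes "smooth_on I c" "open I"
  shows "smooth_on I (deriv c)"
proof -
  have "deriv c = (\<lambda>s. vector_derivative c (at s))"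
    using field_derivative_eq_vector_derivative[of c] by auto
  then show ?thesis using smooth_on_vector_derivative[OF assms] by simp
qed

text \<open>The chain rule along a curve in the parameter domain. With one coordinate held constant
  it also yields the ordinary one-variable derivatives along coordinate lines.\<close>

lemma has_vector_derivative_param:
  fixes X :: "real \<times> real \<Rightarrow> 'b::real_normed_vector"
  assumes "smooth_on U X" "(t s, z s) \<in> U"
    and t: "(t has_real_derivative t') (at s)" and z: "(z has_real_derivative z') (at s)"
  shows "((\<lambda>s. X (t s, z s)) has_vector_derivative
           t' *\<^sub>R partial 1 X (t s, z s) + z' *\<^sub>R partial 2 X (t s, z s)) (at s)"
proof -
  have "((\<lambda>s. (t s, z s)) has_derivative (\<lambda>h. (t' * h, z' * h))) (at s)"
    using t z unfolding has_field_derivative_def by (rule has_derivative_Pair)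
  from has_derivative_compose[OF this smooth_on_has_derivative[OF assms(1,2)]]
  show ?thesis
    by (simp add: has_vector_derivative_def scaleR_add_right mult.commute)
qed

section \<open>Symmetry of mixed partial derivatives\<close>

text \<open>The mean value theorem is applied twice: in the first variable to
  \<open>f x (b+h) - f x b\<close>, then in the second variable to \<open>f1 x\<close> at the
  intermediate point \<open>x\<close>.\<close>

lemma second_difference_mvt:
  fixes f f1 f12 :: "real \<Rightarrow> real \<Rightarrow> real"
  assumes "h > 0"
    and f1: "\<And>x y. x \<in> {a..a+h} \<Longrightarrow> y \<in> {b..b+h} \<Longrightarrow> ((\<lambda>x. f x y) has_real_derivative f1 x y) (at x)"
    and f12: "\<And>x y. x \<in> {a..a+h} \<Longrightarrow> y \<in> {b..b+h} \<Longrightarrow> ((\<lambda>y. f1 x y) has_real_derivative f12 x y) (at y)"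
  shows "\<exists>x\<in>{a..a+h}. \<exists>y\<in>{b..b+h}. f (a+h) (b+h) - f (a+h) b - f a (b+h) + f a b = h * h * f12 x y"
proof -
  have "\<exists>x>a. x < a + h \<and> (f (a+h) (b+h) - f (a+h) b) - (f a (b+h) - f a b)
      = (a + h - a) * (f1 x (b+h) - f1 x b)"
    by (rule MVT2) (use \<open>h > 0\<close> in \<open>auto intro!: DERIV_diff f1\<close>)
  then obtain x where x: "a < x" "x < a + h"
    "f (a+h) (b+h) - f (a+h) b - f a (b+h) + f a b = h * (f1 x (b+h) - f1 x b)"
    by (auto simp: algebra_simps)
  have "\<exists>y>b. y < b + h \<and> f1 x (b+h) - f1 x b = (b + h - b) * f12 x y"
    by (rule MVT2) (use \<open>h > 0\<close> x in \<open>auto intro!: f12\<close>)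
  then obtain y where "b < y" "y < b + h" "f1 x (b+h) - f1 x b = h * f12 x y"
    by auto
  with x show ?thesis by (intro bexI[of _ x] bexI[of _ y]) auto
qed

lemma smooth_on_partial_real:
  fixes X :: "real \<times> real \<Rightarrow> 'b::real_inner"
  assumes "smooth_on U X" "(x, y) \<in> U"
  shows "((\<lambda>x. X (x, y) \<bullet> v) has_real_derivative partial 1 X (x, y) \<bullet> v) (at x)"
    and "((\<lambda>y. X (x, y) \<bullet> v) has_real_derivative partial 2 X (x, y) \<bullet> v) (at y)"
proof -
  have "((\<lambda>x. X (x, y)) has_vector_derivative partial 1 X (x, y)) (at x)"
    using has_vector_derivative_param[where t = "\<lambda>x. x" and z = "\<lambda>_. y", OF assms, of 1 0] by simp
  then show "((\<lambda>x. X (x, y) \<bullet> v) has_real_derivative partial 1 X (x, y) \<bullet> v) (at x)"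
    unfolding has_real_derivative_iff_has_vector_derivative
    by (rule bounded_linear.has_vector_derivative[OF bounded_linear_inner_left])
  have "((\<lambda>y. X (x, y)) has_vector_derivative partial 2 X (x, y)) (at y)"
    using has_vector_derivative_param[where t = "\<lambda>_. x" and z = "\<lambda>y. y", OF assms, of 0 1] by simp
  then show "((\<lambda>y. X (x, y) \<bullet> v) has_real_derivative partial 2 X (x, y) \<bullet> v) (at y)"
    unfolding has_real_derivative_iff_has_vector_derivative
    by (rule bounded_linear.has_vector_derivative[OF bounded_linear_inner_left])
qed

text \<open>Schwarz's theorem: the second difference of \<open>X\<close> over a small square with
  corner \<open>p\<close>, divided by the area, is a value of either mixed partial at some point of
  the square. Continuity of both at \<open>p\<close> forces equality there.\<close>

lemma partial_commute:
  fixes X :: "real \<times> real \<Rightarrow> 'b::real_inner"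
  assumes X: "smooth_on U X" and "open U" "p \<in> U"
  shows "partial 2 (partial 1 X) p = partial 1 (partial 2 X) p"
proof -
  obtain a b where p: "p = (a, b)" by fastforce
  have sm: "smooth_on U (partial i X)" "smooth_on U (partial j (partial i X))" for i j
    using X smooth_on_partial by blast+
  \<comment> \<open>The mean value theorem concerns real functions, so \<open>X\<close> is tested
    against an arbitrary vector \<open>v\<close>.\<close>
  have "partial 2 (partial 1 X) p \<bullet> v = partial 1 (partial 2 X) p \<bullet> v" for v
  proof -
    let ?F = "\<lambda>q. partial 2 (partial 1 X) q \<bullet> v"
    let ?H = "\<lambda>q. partial 1 (partial 2 X) q \<bullet> v"
    have cont: "isCont ?F p" "isCont ?H p"
      using sm(2)[THEN smooth_on_continuous_on] continuous_on_eq_continuous_at[OF \<open>open U\<close>] \<open>p \<in> U\<close>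
      by (auto intro!: continuous_intros)
    have "dist (?F p) (?H p) < e" if "e > 0" for e
    proof -
      obtain d1 where d1: "d1 > 0" "\<And>q. dist q p < d1 \<Longrightarrow> dist (?F q) (?F p) < e/2"
        using cont(1)[unfolded continuous_at_eps_delta] \<open>e > 0\<close> half_gt_zero by blast
      obtain d2 where d2: "d2 > 0" "\<And>q. dist q p < d2 \<Longrightarrow> dist (?H q) (?H p) < e/2"
        using cont(2)[unfolded continuous_at_eps_delta] \<open>e > 0\<close> half_gt_zero by blast
      obtain d3 where d3: "d3 > 0" "\<And>q. dist q p < d3 \<Longrightarrow> q \<in> U"
        using \<open>open U\<close> \<open>p \<in> U\<close> unfolding open_dist by blast
      \<comment> \<open>The three radii secure the two continuity estimates and membership in
        \<open>U\<close>. Points of the square lie within \<open>2 * h\<close> of \<open>p\<close>,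
        so a third of the minimum leaves a strict inequality.\<close>
      define h where "h = Min {d1, d2, d3} / 3"
      have h: "h > 0" "3 * h \<le> d1" "3 * h \<le> d2" "3 * h \<le> d3"
        using d1 d2 d3 by (auto simp: h_def)
      have near: "dist (x, y) p < 3 * h" if "x \<in> {a..a+h}" "y \<in> {b..b+h}" for x y
      proof -
        have "dist (x, y) p \<le> \<bar>x - a\<bar> + \<bar>y - b\<bar>"
          by (simp add: p dist_prod_def dist_real_def sqrt_sum_squares_le_sum_abs)
        then show ?thesis using that h(1) by auto
      qed
      then have inU: "(x, y) \<in> U" if "x \<in> {a..a+h}" "y \<in> {b..b+h}" for x y
        using d3(2) h that by fastforce
      obtain x y where xy: "x \<in> {a..a+h}" "y \<in> {b..b+h}"
        "X (a+h,b+h) \<bullet> v - X (a+h,b) \<bullet> v - X (a,b+h) \<bullet> v + X (a,b) \<bullet> v = h * h * ?F (x,y)"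
        using second_difference_mvt[of h a b "\<lambda>x y. X (x,y) \<bullet> v" "\<lambda>x y. partial 1 X (x,y) \<bullet> v" "\<lambda>x y. ?F (x,y)"]
          h(1) smooth_on_partial_real(1)[OF X inU] smooth_on_partial_real(2)[OF sm(1) inU] by blast
      \<comment> \<open>The second difference is symmetric in the two variables; exchanging their
        roles produces the other mixed partial.\<close>
      obtain y' x' where xy': "y' \<in> {b..b+h}" "x' \<in> {a..a+h}"
        "X (a+h,b+h) \<bullet> v - X (a,b+h) \<bullet> v - X (a+h,b) \<bullet> v + X (a,b) \<bullet> v = h * h * ?H (x',y')"
        using second_difference_mvt[of h b a "\<lambda>y x. X (x,y) \<bullet> v" "\<lambda>y x. partial 2 X (x,y) \<bullet> v" "\<lambda>y x. ?H (x,y)"]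
          h(1) smooth_on_partial_real(2)[OF X inU] smooth_on_partial_real(1)[OF sm(1) inU] by blast
      have "h * h * ?F (x,y) = h * h * ?H (x',y')" using xy(3) xy'(3) by linarith
      then have "?F (x,y) = ?H (x',y')" using h(1) by simp
      moreover have "dist (?F (x,y)) (?F p) < e/2" "dist (?H (x',y')) (?H p) < e/2"
        using near[OF xy(1,2)] near[OF xy'(2,1)] h d1(2) d2(2) by force+
      ultimately show ?thesis by (smt (verit) dist_commute dist_triangle field_sum_of_halves)
    qed
    then show ?thesis by (metis dist_eq_0_iff less_irrefl zero_less_dist_iff)
  qed
  then show ?thesis using vector_eq_rdot by blast
qed

section \<open>Christoffel symbols of an orthogonal parametrization\<close>

lemma partial_first_form:
  assumes "smooth_on U X" "p \<in> U"
  shows "partial i (first_form X j k) p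
    = partial i (partial j X) p \<bullet> partial k X p + partial j X p \<bullet> partial i (partial k X) p"
proof -
  have d: "(partial l X has_derivative frechet_derivative (partial l X) (at p)) (at p)" for l
    using smooth_on_differentiable[OF smooth_on_partial[OF assms(1)] assms(2)]
      frechet_derivative_works by blast
  have "((\<lambda>p. partial j X p \<bullet> partial k X p) has_derivative
      (\<lambda>h. partial j X p \<bullet> frechet_derivative (partial k X) (at p) h
         + frechet_derivative (partial j X) (at p) h \<bullet> partial k X p)) (at p)"
    by (intro has_derivative_inner d)
  from partial_eqI[OF this, of i] show ?thesis
    by (simp add: first_form_def[abs_def] partial_def)
qed

text \<open>\<open>matrix_inv\<close> is defined by choice, so an explicit inverse \<open>B\<close>
  first shows invertibility, and uniqueness of inverses then identifies the chosen matrix with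
  \<open>B\<close>.\<close>

lemma matrix_inv_diagonal_2:
  fixes A :: "real^2^2"
  assumes "A $ 1 $ 2 = 0" "A $ 2 $ 1 = 0" "A $ 1 $ 1 \<noteq> 0" "A $ 2 $ 2 \<noteq> 0"
  shows "matrix_inv A = (\<chi> i j. if i = j then 1 / A $ i $ i else 0)"
proof -
  define B :: "real^2^2" where "B = (\<chi> i j. if i = j then 1 / A $ i $ i else 0)"
  have AB: "A ** B = mat 1" "B ** A = mat 1"
    using assms by (simp_all add: B_def vec_eq_iff matrix_matrix_mult_def mat_def forall_2 sum_2)
  then have "invertible A" unfolding invertible_def by blast
  then have "matrix_inv A ** A = mat 1" unfolding invertible_def matrix_inv_def by (rule someI2_ex) blast
  then have "matrix_inv A = B"
    using AB by (metis matrix_mul_assoc matrix_mul_lid matrix_mul_rid)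
  then show ?thesis by (simp add: B_def)
qed

text \<open>As the inverse metric is diagonal, only the summand \<open>l = k\<close> survives. In
  the combination of metric derivatives the product rule and symmetry of second partials cancel all
  but twice one term, and the 2 cancels the denominator in the definition.\<close>

lemma christoffel_orthogonal:
  assumes "smooth_on U X" "open U" "p \<in> U"
    and "first_form X 1 2 p = 0" "first_form X 1 1 p \<noteq> 0" "first_form X 2 2 p \<noteq> 0"
  shows "christoffel X i j k p
    = partial j (partial i X) p \<bullet> partial k X p / first_form X k k p"
proof -
  have sym: "partial i (partial j X) p = partial j (partial i X) p" for i j
    using partial_commute[OF assms(1-3)] exhaust_2[of i] exhaust_2[of j] by auto
  have inv: "inverse_first_form X k l p = (if k = l then 1 / first_form X k k p else 0)" for l
    unfolding inverse_first_form_def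
    by (subst matrix_inv_diagonal_2)
      (use assms in \<open>auto simp: first_form_def inner_commute\<close>)
  have "partial i (first_form X j l) p + partial j (first_form X i l) p - partial l (first_form X i j) p
    = 2 * (partial j (partial i X) p \<bullet> partial l X p)" for l
    unfolding partial_first_form[OF assms(1,3)]
    using sym[of i j] sym[of i l] sym[of j l] by (simp add: inner_commute)
  then show ?thesis
    using exhaust_2[of k] by (auto simp: christoffel_def inv sum_2)
qed

section \<open>Cross products in the frame of an orthogonal parametrization\<close>

text \<open>The length of \<open>cross3 a b\<close> is the product of the lengths of
  \<open>a\<close> and \<open>b\<close>, and the triple product expansion gives the directions. The
  square roots become \<open>sqrt (E / G)\<close> and \<open>sqrt (G / E)\<close> in the
  differential equations.\<close>

lemma orthogonal_frame_cross:
  fixes a b :: "real^3"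
  assumes "a \<bullet> b = 0" "cross3 a b \<noteq> 0" and n: "n = cross3 a b /\<^sub>R norm (cross3 a b)"
  shows "norm n = 1" "n \<bullet> a = 0" "n \<bullet> b = 0"
    "cross3 n a = sqrt ((a \<bullet> a) / (b \<bullet> b)) *\<^sub>R b"
    "cross3 n b = - sqrt ((b \<bullet> b) / (a \<bullet> a)) *\<^sub>R a"
proof -
  have ab: "a \<bullet> a > 0" "b \<bullet> b > 0" using assms(2) by auto
  have "(norm (cross3 a b))\<^sup>2 = (a \<bullet> a) * (b \<bullet> b)"
    using norm_cross[of a b] assms(1) by (simp add: power2_norm_eq_inner)
  then have nrm: "norm (cross3 a b) = sqrt (a \<bullet> a) * sqrt (b \<bullet> b)"
    by (metis norm_ge_zero real_sqrt_mult real_sqrt_unique)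
  show "norm n = 1" using assms(2) by (simp add: n)
  show "n \<bullet> a = 0" "n \<bullet> b = 0" by (simp_all add: n dot_cross_self)
  have "cross3 (cross3 a b) a = (a \<bullet> a) *\<^sub>R b" "cross3 (cross3 a b) b = - (b \<bullet> b) *\<^sub>R a"
    using assms(1) Lagrange[of a a b] Lagrange[of b a b]
    by (simp_all add: cross_skew[of "cross3 a b"] inner_commute)
  then show "cross3 n a = sqrt ((a \<bullet> a) / (b \<bullet> b)) *\<^sub>R b"
    "cross3 n b = - sqrt ((b \<bullet> b) / (a \<bullet> a)) *\<^sub>R a"
    using ab real_div_sqrt[of "a \<bullet> a"] real_div_sqrt[of "b \<bullet> b"]
    by (simp_all add: n cross_mult_left nrm real_sqrt_divide field_simps del: real_div_sqrt)
qed

text \<open>By the triple product expansion \<open>v\<close> is parallel to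
  \<open>cross3 a b\<close>, and it is also orthogonal to that nonzero vector.\<close>

lemma orthogonal_frame_eq_0:
  fixes a b v :: "real^3"
  assumes "cross3 a b \<noteq> 0" "v \<bullet> a = 0" "v \<bullet> b = 0" "v \<bullet> cross3 a b = 0"
  shows "v = 0"
proof -
  have "cross3 v (cross3 a b) = 0" by (simp add: Lagrange assms)
  then show ?thesis using norm_and_cross_eq_0[of v "cross3 a b"] assms by blast
qed

section \<open>Acceleration of a curve on the surface and its tangential components\<close>

lemma param_curve_acceleration:
  fixes X :: "real \<times> real \<Rightarrow> 'b::real_inner"
  assumes X: "smooth_on U X" "open U" and I: "open I" "s \<in> I"
    and t: "smooth_on I t" and z: "smooth_on I z"
    and \<gamma>: "\<And>s. s \<in> I \<Longrightarrow> (t s, z s) \<in> U \<and> \<gamma> s = X (t s, z s)"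
  shows "vector_derivative \<gamma> (at s)
      = deriv t s *\<^sub>R partial 1 X (t s, z s) + deriv z s *\<^sub>R partial 2 X (t s, z s)"
    and "vector_derivative (\<lambda>s. vector_derivative \<gamma> (at s)) (at s)
      = deriv (deriv t) s *\<^sub>R partial 1 X (t s, z s) + deriv (deriv z) s *\<^sub>R partial 2 X (t s, z s)
        + (deriv t s)\<^sup>2 *\<^sub>R partial 1 (partial 1 X) (t s, z s)
        + (2 * deriv t s * deriv z s) *\<^sub>R partial 2 (partial 1 X) (t s, z s)
        + (deriv z s)\<^sup>2 *\<^sub>R partial 2 (partial 2 X) (t s, z s)" (is "_ = ?A")
proof -
  have v: "vector_derivative \<gamma> (at s)
      = deriv t s *\<^sub>R partial 1 X (t s, z s) + deriv z s *\<^sub>R partial 2 X (t s, z s)" if "s \<in> I" for s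
    by (rule vector_derivative_at,
        rule has_vector_derivative_transform_within_open[where f = "\<lambda>s. X (t s, z s)" and S = I],
        rule has_vector_derivative_param[where U = U])
      (use that \<gamma> X I t z smooth_on_has_real_derivative in auto)
  show "vector_derivative \<gamma> (at s)
      = deriv t s *\<^sub>R partial 1 X (t s, z s) + deriv z s *\<^sub>R partial 2 X (t s, z s)"
    by (rule v) fact
  have d: "((\<lambda>s. partial i X (t s, z s)) has_vector_derivative
      deriv t s *\<^sub>R partial 1 (partial i X) (t s, z s)
      + deriv z s *\<^sub>R partial 2 (partial i X) (t s, z s)) (at s)" for i
    by (rule has_vector_derivative_param[where U = U])
      (use I \<gamma> X t z smooth_on_has_real_derivative smooth_on_partial in auto)
  have dd: "(deriv t has_real_derivative deriv (deriv t) s) (at s)"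
    "(deriv z has_real_derivative deriv (deriv z) s) (at s)"
    using smooth_on_has_real_derivative[OF smooth_on_deriv] t z I by blast+
  have "((\<lambda>s. deriv t s *\<^sub>R partial 1 X (t s, z s) + deriv z s *\<^sub>R partial 2 X (t s, z s))
      has_vector_derivative ?A) (at s)"
  proof -
    \<comment> \<open>The product rule produces one mixed term from each summand of the velocity.
      The doubled coefficient is split to match them, and \<open>partial_commute\<close> makes the
      two mixed partials equal.\<close>
    have two: "(2 * deriv t s * deriv z s) *\<^sub>R w
        = (deriv t s * deriv z s) *\<^sub>R w + (deriv t s * deriv z s) *\<^sub>R w" for w :: 'b
      by (simp flip: scaleR_add_left)
    show ?thesis
      unfolding two
      using has_vector_derivative_add[OF has_vector_derivative_scaleR[OF dd(1) d[of 1]]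
        has_vector_derivative_scaleR[OF dd(2) d[of 2]]]
      partial_commute[OF X, of "(t s, z s)"] \<gamma>[OF \<open>s \<in> I\<close>]
      by (simp add: algebra_simps power2_eq_square)
  qed
  then have "((\<lambda>s. vector_derivative \<gamma> (at s)) has_vector_derivative ?A) (at s)"
    by (rule has_vector_derivative_transform_within_open[OF _ I]) (simp add: v)
  then show "vector_derivative (\<lambda>s. vector_derivative \<gamma> (at s)) (at s) = ?A"
    by (rule vector_derivative_at)
qed

text \<open>The difference \<open>D\<close> of the two sides of the vector equation is always
  orthogonal to \<open>n\<close>, so it vanishes exactly when its \<open>a\<close> and
  \<open>b\<close> components do. Turning by \<open>cross3 n\<close> exchanges the two directions
  with opposite signs, whence \<open>y\<close> with a plus in the first equation and
  \<open>x\<close> with a minus in the second.\<close>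

lemma tangential_equations_iff:
  fixes a b A :: "real^3"
  assumes ab: "a \<bullet> b = 0" "cross3 a b \<noteq> 0" and n: "n = cross3 a b /\<^sub>R norm (cross3 a b)"
  shows "A \<bullet> a / (a \<bullet> a) + \<tau> * y * sqrt ((b \<bullet> b) / (a \<bullet> a)) * (A \<bullet> n) = 0 \<and>
      A \<bullet> b / (b \<bullet> b) - \<tau> * x * sqrt ((a \<bullet> a) / (b \<bullet> b)) * (A \<bullet> n) = 0
    \<longleftrightarrow> A = (A \<bullet> n) *\<^sub>R (n + \<tau> *\<^sub>R cross3 n (x *\<^sub>R a + y *\<^sub>R b))"
proof -
  note fr = orthogonal_frame_cross[OF ab n]
  have pos: "a \<bullet> a > 0" "b \<bullet> b > 0" using ab(2) by auto
  define D where "D = A - (A \<bullet> n) *\<^sub>R (n + \<tau> *\<^sub>R cross3 n (x *\<^sub>R a + y *\<^sub>R b))"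
  have Da: "D \<bullet> a = A \<bullet> a + \<tau> * y * sqrt ((b \<bullet> b) / (a \<bullet> a)) * (A \<bullet> n) * (a \<bullet> a)"
    and Db: "D \<bullet> b = A \<bullet> b - \<tau> * x * sqrt ((a \<bullet> a) / (b \<bullet> b)) * (A \<bullet> n) * (b \<bullet> b)"
    using ab(1) ab(1)[unfolded inner_commute[of a]]
    by (simp_all add: D_def cross_add_right cross_mult_right fr inner_diff_left algebra_simps)
  have "n \<bullet> n = 1" using fr(1) by (simp add: dot_square_norm)
  then have "D \<bullet> n = 0"
    by (simp add: D_def inner_add_left inner_diff_left dot_cross_self)
  then have "D \<bullet> cross3 a b = 0" using ab(2) by (simp add: n)
  then have "D = 0 \<longleftrightarrow> D \<bullet> a = 0 \<and> D \<bullet> b = 0"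
    using orthogonal_frame_eq_0[OF ab(2), of D] by auto
  also have "\<dots> \<longleftrightarrow> A \<bullet> a / (a \<bullet> a) + \<tau> * y * sqrt ((b \<bullet> b) / (a \<bullet> a)) * (A \<bullet> n) = 0 \<and>
      A \<bullet> b / (b \<bullet> b) - \<tau> * x * sqrt ((a \<bullet> a) / (b \<bullet> b)) * (A \<bullet> n) = 0"
    using pos by (simp add: Da Db field_simps)
  finally show ?thesis by (simp add: D_def)
qed

lemma nonvanishing_constant_sign:
  fixes h :: "real \<Rightarrow> real"
  assumes "is_interval I" "continuous_on I h" "\<And>s. s \<in> I \<Longrightarrow> h s \<noteq> 0"
  shows "(\<forall>s\<in>I. h s > 0) \<or> (\<forall>s\<in>I. h s < 0)"
proof (rule ccontr)
  assume "\<not> ?thesis"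
  then obtain u v where "u \<in> I" "v \<in> I" "h u < 0" "0 < h v"
    using assms(3) by (metis linorder_neqE_linordered_idom)
  moreover have "connected (h ` I)"
    using assms(1,2) connected_continuous_image is_interval_connected by blast
  ultimately have "0 \<in> h ` I"
    by (meson connectedD_interval image_eqI order_less_imp_le)
  then show False using assms(3) by auto
qed

section \<open>Pseudo-geodesics and the equations for their coordinate functions\<close>

theorem proposition14:
  fixes M :: "(real^3) set" and N :: "real^3 \<Rightarrow> real^3"
    and U :: "(real \<times> real) set" and X :: "real \<times> real \<Rightarrow> real^3"
    and I :: "real set" and \<gamma> :: "real \<Rightarrow> real^3" and t z :: "real \<Rightarrow> real"
    and E G e f g :: "real \<Rightarrow> real" and \<Gamma> :: "2 \<Rightarrow> 2 \<Rightarrow> 2 \<Rightarrow> real \<Rightarrow> real"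
  assumes "regular_surface M" and "connected M" and "gauss_map M N"
    and "regular_parametrization M U X" and "positively_oriented N U X"
    and "\<And>p. p \<in> U \<Longrightarrow> first_form X 1 2 p = 0"
    and "arc_length_curve I \<gamma>"
    and "smooth_on I t" and "smooth_on I z"
    and "\<And>s. s \<in> I \<Longrightarrow> (t s, z s) \<in> U \<and> \<gamma> s = X (t s, z s)"
    and "E = (\<lambda>s. first_form X 1 1 (t s, z s))"
    and "G = (\<lambda>s. first_form X 2 2 (t s, z s))"
    and "e = (\<lambda>s. second_form N X 1 1 (t s, z s))"
    and "f = (\<lambda>s. second_form N X 1 2 (t s, z s))"
    and "g = (\<lambda>s. second_form N X 2 2 (t s, z s))"
    and "\<Gamma> = (\<lambda>i j k s. christoffel X i j k (t s, z s))"
  shows "(\<exists>\<theta>. pseudo_geodesic M N I \<gamma> \<theta> \<and> cos \<theta> \<noteq> 0) \<longleftrightarrow>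
    (\<exists>\<theta>. cos \<theta> \<noteq> 0 \<and> (\<forall>s\<in>I.
       deriv (deriv t) s
         + (deriv t s)^2 * (\<Gamma> 1 1 1 s + tan \<theta> * deriv z s * sqrt (G s / E s) * e s)
         + 2 * deriv t s * deriv z s * (\<Gamma> 1 2 1 s + tan \<theta> * deriv z s * sqrt (G s / E s) * f s)
         + (deriv z s)^2 * (\<Gamma> 2 2 1 s + tan \<theta> * deriv z s * sqrt (G s / E s) * g s) = 0 \<and>
       deriv (deriv z) s
         + (deriv t s)^2 * (\<Gamma> 1 1 2 s - tan \<theta> * deriv t s * sqrt (E s / G s) * e s)
         + 2 * deriv t s * deriv z s * (\<Gamma> 1 2 2 s - tan \<theta> * deriv t s * sqrt (E s / G s) * f s)
         + (deriv z s)^2 * (\<Gamma> 2 2 2 s - tan \<theta> * deriv t s * sqrt (E s / G s) * g s) = 0))"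
proof -
  have X: "smooth_on U X" "open U" and XM: "X ` U \<subseteq> M"
    and reg: "\<And>p. p \<in> U \<Longrightarrow> cross3 (partial 1 X p) (partial 2 X p) \<noteq> 0"
    using assms(4) by (auto simp: regular_parametrization_def)
  have I: "open I" "is_interval I" and "smooth_on I \<gamma>"
    and unit: "\<And>s. s \<in> I \<Longrightarrow> norm (unit_tangent \<gamma> s) = 1"
    and curv: "\<And>s. s \<in> I \<Longrightarrow> curvature \<gamma> s > 0"
    using assms(7) by (auto simp: arc_length_curve_def)
  have U: "\<And>s. s \<in> I \<Longrightarrow> (t s, z s) \<in> U" and \<gamma>X: "\<And>s. s \<in> I \<Longrightarrow> \<gamma> s = X (t s, z s)"
    using assms(10) by auto
  have \<gamma>M: "\<gamma> ` I \<subseteq> M" using U \<gamma>X XM by force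

  define a where "a s = partial 1 X (t s, z s)" for s
  define b where "b s = partial 2 X (t s, z s)" for s
  define n where "n s = N (\<gamma> s)" for s
  define T where "T = unit_tangent \<gamma>"
  define A where "A s = vector_derivative T (at s)" for s
  define L where "L s = A s \<bullet> n s" for s
  define V where "V s = cross3 (n s) (T s)" for s

  have ab: "a s \<bullet> b s = 0" "cross3 (a s) (b s) \<noteq> 0" if "s \<in> I" for s
    using assms(6) reg U that by (auto simp: a_def b_def first_form_def)
  have n: "n s = cross3 (a s) (b s) /\<^sub>R norm (cross3 (a s) (b s))" if "s \<in> I" for s
    using assms(5) U \<gamma>X that by (simp add: n_def a_def b_def positively_oriented_def)
  have T: "T s = deriv t s *\<^sub>R a s + deriv z s *\<^sub>R b s"
    and A: "A s = deriv (deriv t) s *\<^sub>R a s + deriv (deriv z) s *\<^sub>R b s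
        + (deriv t s)\<^sup>2 *\<^sub>R partial 1 (partial 1 X) (t s, z s)
        + (2 * deriv t s * deriv z s) *\<^sub>R partial 2 (partial 1 X) (t s, z s)
        + (deriv z s)\<^sup>2 *\<^sub>R partial 2 (partial 2 X) (t s, z s)" if "s \<in> I" for s
    using param_curve_acceleration[OF X I(1) that assms(8,9,10)]
    by (simp_all add: T_def A_def a_def b_def unit_tangent_def[abs_def])
  \<comment> \<open>\<open>n s\<close> and \<open>V s\<close> form an orthonormal basis of the plane
    normal to the curve, in which the principal normal is expanded.\<close>
  have nn: "n s \<bullet> n s = 1" "n s \<bullet> V s = 0" "V s \<bullet> n s = 0" "V s \<bullet> V s = 1" if "s \<in> I" for s
  proof -
    note fr = orthogonal_frame_cross[OF ab[OF that] n[OF that]]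
    show 1: "n s \<bullet> n s = 1" using fr(1) by (simp add: dot_square_norm)
    show "n s \<bullet> V s = 0" "V s \<bullet> n s = 0" by (simp_all add: V_def dot_cross_self)
    have "T s \<bullet> T s = 1" using unit[OF that] by (simp add: T_def dot_square_norm)
    moreover have "n s \<bullet> T s = 0" using fr(2,3) by (simp add: T[OF that] inner_add_right)
    ultimately show "V s \<bullet> V s = 1" using 1 by (simp add: V_def dot_cross inner_commute)
  qed

  \<comment> \<open>This is \<open>tangential_equations_iff\<close> with
    \<open>\<tau> = tan \<theta>\<close>, \<open>x = deriv t s\<close>,
    \<open>y = deriv z s\<close>, once the coefficients are recognised as components of
    \<open>A s\<close>.\<close>
  have equations: "deriv (deriv t) s
         + (deriv t s)^2 * (\<Gamma> 1 1 1 s + tan \<theta> * deriv z s * sqrt (G s / E s) * e s)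
         + 2 * deriv t s * deriv z s * (\<Gamma> 1 2 1 s + tan \<theta> * deriv z s * sqrt (G s / E s) * f s)
         + (deriv z s)^2 * (\<Gamma> 2 2 1 s + tan \<theta> * deriv z s * sqrt (G s / E s) * g s) = 0 \<and>
       deriv (deriv z) s
         + (deriv t s)^2 * (\<Gamma> 1 1 2 s - tan \<theta> * deriv t s * sqrt (E s / G s) * e s)
         + 2 * deriv t s * deriv z s * (\<Gamma> 1 2 2 s - tan \<theta> * deriv t s * sqrt (E s / G s) * f s)
         + (deriv z s)^2 * (\<Gamma> 2 2 2 s - tan \<theta> * deriv t s * sqrt (E s / G s) * g s) = 0
     \<longleftrightarrow> A s = L s *\<^sub>R (n s + tan \<theta> *\<^sub>R V s)" (is "?e1 = 0 \<and> ?e2 = 0 \<longleftrightarrow> _")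
    if s: "s \<in> I" for s \<theta>
  proof -
    have EG: "E s = a s \<bullet> a s" "G s = b s \<bullet> b s"
      by (simp_all add: assms(11,12) a_def b_def first_form_def)
    have pos: "a s \<bullet> a s \<noteq> 0" "b s \<bullet> b s \<noteq> 0" using ab(2)[OF s] by auto
    have ba: "b s \<bullet> a s = 0" using ab(1)[OF s] by (simp add: inner_commute)
    have \<Gamma>: "\<Gamma> i j k s = partial j (partial i X) (t s, z s) \<bullet> partial k X (t s, z s)
        / (partial k X (t s, z s) \<bullet> partial k X (t s, z s))" for i j k
      unfolding assms(16)
      by (subst christoffel_orthogonal[OF X U[OF s]])
        (use assms(6) U[OF s] pos in \<open>auto simp: first_form_def a_def b_def\<close>)
    \<comment> \<open>The terms with \<open>deriv (deriv t)\<close> and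
      \<open>deriv (deriv z)\<close> are tangential, so only the second fundamental form of the
      velocity remains.\<close>
    have L: "L s = (deriv t s)\<^sup>2 * e s + 2 * deriv t s * deriv z s * f s + (deriv z s)\<^sup>2 * g s"
    proof -
      have "a s \<bullet> n s = 0" "b s \<bullet> n s = 0"
        using orthogonal_frame_cross(2,3)[OF ab[OF s] n[OF s]] by (simp_all add: inner_commute)
      then show ?thesis
        by (simp add: L_def A[OF s] inner_add_left assms(13-15) second_form_def n_def \<gamma>X[OF s])
    qed
    \<comment> \<open>Since \<open>b s\<close> is orthogonal to \<open>a s\<close>, dividing by
      \<open>a s \<bullet> a s\<close> leaves the second derivative of \<open>t\<close> and the
      Christoffel terms; the \<open>tan \<theta>\<close> terms then collect into a multiple of
      \<open>L s\<close>.\<close>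
    have "A s \<bullet> a s / (a s \<bullet> a s) = deriv (deriv t) s + (deriv t s)\<^sup>2 * \<Gamma> 1 1 1 s
        + 2 * deriv t s * deriv z s * \<Gamma> 1 2 1 s + (deriv z s)\<^sup>2 * \<Gamma> 2 2 1 s"
      using pos by (simp add: A[OF s] \<Gamma> inner_add_left ba add_divide_distrib flip: a_def)
    then have "?e1 = A s \<bullet> a s / (a s \<bullet> a s)
        + tan \<theta> * deriv z s * sqrt ((b s \<bullet> b s) / (a s \<bullet> a s)) * L s"
      unfolding L EG by algebra
    moreover have "A s \<bullet> b s / (b s \<bullet> b s) = deriv (deriv z) s + (deriv t s)\<^sup>2 * \<Gamma> 1 1 2 s
        + 2 * deriv t s * deriv z s * \<Gamma> 1 2 2 s + (deriv z s)\<^sup>2 * \<Gamma> 2 2 2 s"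
      using pos by (simp add: A[OF s] \<Gamma> inner_add_left ab(1)[OF s] add_divide_distrib flip: b_def)
    then have "?e2 = A s \<bullet> b s / (b s \<bullet> b s)
        - tan \<theta> * deriv t s * sqrt ((a s \<bullet> a s) / (b s \<bullet> b s)) * L s"
      unfolding L EG by algebra
    ultimately show ?thesis
      using tangential_equations_iff[OF ab[OF s] n[OF s]] by (simp add: L_def V_def T[OF s])
  qed

  have "(\<exists>\<theta>. pseudo_geodesic M N I \<gamma> \<theta> \<and> cos \<theta> \<noteq> 0) \<longleftrightarrow>
    (\<exists>\<theta>. cos \<theta> \<noteq> 0 \<and> (\<forall>s\<in>I. A s = L s *\<^sub>R (n s + tan \<theta> *\<^sub>R V s)))"
  proof (intro iffI; elim exE conjE)
    fix \<theta>
    assume pg: "pseudo_geodesic M N I \<gamma> \<theta>" and c: "cos \<theta> \<noteq> 0"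
    have "A s = L s *\<^sub>R (n s + tan \<theta> *\<^sub>R V s)" if s: "s \<in> I" for s
    proof -
      have "A s /\<^sub>R curvature \<gamma> s = sin \<theta> *\<^sub>R V s + cos \<theta> *\<^sub>R n s"
        using pg s by (simp add: pseudo_geodesic_def principal_normal_def A_def T_def V_def n_def)
      then have *: "A s = curvature \<gamma> s *\<^sub>R (sin \<theta> *\<^sub>R V s + cos \<theta> *\<^sub>R n s)"
        using curv[OF s] by (metis less_irrefl scaleR_scaleR right_inverse scaleR_one)
      \<comment> \<open>The inner product with \<open>n s\<close> removes the \<open>V s\<close>
        part.\<close>
      then have "L s = curvature \<gamma> s * cos \<theta>"
        using nn[OF s] by (simp add: L_def inner_add_left)
      with * c show ?thesis by (simp add: tan_def algebra_simps)
    qed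
    with c show "\<exists>\<theta>. cos \<theta> \<noteq> 0 \<and> (\<forall>s\<in>I. A s = L s *\<^sub>R (n s + tan \<theta> *\<^sub>R V s))"
      by blast
  next
    fix \<theta>
    assume c: "cos \<theta> \<noteq> 0" and eq: "\<forall>s\<in>I. A s = L s *\<^sub>R (n s + tan \<theta> *\<^sub>R V s)"
    \<comment> \<open>A signed curvature: \<open>A s\<close> is \<open>\<mu> s\<close> times a unit
      vector, so \<open>\<mu> s\<close> equals the curvature up to sign.\<close>
    define \<mu> where "\<mu> s = L s / cos \<theta>" for s
    have A': "A s = \<mu> s *\<^sub>R (sin \<theta> *\<^sub>R V s + cos \<theta> *\<^sub>R n s)"
      and \<kappa>: "curvature \<gamma> s = \<bar>\<mu> s\<bar>" if s: "s \<in> I" for s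
    proof -
      show *: "A s = \<mu> s *\<^sub>R (sin \<theta> *\<^sub>R V s + cos \<theta> *\<^sub>R n s)"
        using eq s c by (simp add: \<mu>_def tan_def algebra_simps)
      have "(norm (sin \<theta> *\<^sub>R V s + cos \<theta> *\<^sub>R n s))\<^sup>2 = 1"
        unfolding power2_norm_eq_inner
        using nn[OF s] by (simp add: inner_add_left inner_add_right flip: power2_eq_square)
      then have "norm (sin \<theta> *\<^sub>R V s + cos \<theta> *\<^sub>R n s) = 1"
        by (metis norm_ge_zero one_power2 power2_eq_iff_nonneg zero_le_one)
      then show "curvature \<gamma> s = \<bar>\<mu> s\<bar>"
        unfolding curvature_def A_def[symmetric] T_def[symmetric] by (subst *) simp
    qed
    \<comment> \<open>The factor \<open>inverse \<bar>\<mu> s\<bar> * \<mu> s\<close> is the sign of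
      \<open>\<mu> s\<close>; one angle can serve all of \<open>I\<close> once this sign is
      constant.\<close>
    have pn: "principal_normal \<gamma> s = (inverse \<bar>\<mu> s\<bar> * \<mu> s) *\<^sub>R (sin \<theta> *\<^sub>R V s + cos \<theta> *\<^sub>R n s)"
      if "s \<in> I" for s
      unfolding principal_normal_def A_def[symmetric] T_def[symmetric] \<kappa>[OF that]
      by (subst A'[OF that]) (rule scaleR_scaleR)
    have "continuous_on I A"
      unfolding A_def[abs_def] T_def unit_tangent_def[abs_def]
      using \<open>smooth_on I \<gamma>\<close> I(1) smooth_on_vector_derivative smooth_on_continuous_on by blast
    \<comment> \<open>\<open>gauss_map\<close> gives smoothness of \<open>N\<close> through surface
      charts, and \<open>X\<close> need not be one. Continuity comes instead from the formula for
      \<open>n\<close> by the partials of \<open>X\<close>, given by positive orientation.\<close>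
    moreover have "continuous_on I n"
    proof -
      have "continuous_on I (\<lambda>s. (t s, z s))"
        using assms(8,9) smooth_on_continuous_on by (intro continuous_on_Pair) auto
      then have "continuous_on I (\<lambda>s. partial i X (t s, z s))" for i
        using continuous_on_compose2[OF smooth_on_continuous_on[OF smooth_on_partial[OF X(1)]]] U
        by blast
      then have "continuous_on I a" "continuous_on I b" by (simp_all add: a_def[abs_def] b_def[abs_def])
      then have "continuous_on I (\<lambda>s. cross3 (a s) (b s) /\<^sub>R norm (cross3 (a s) (b s)))"
        using ab(2) by (intro continuous_intros continuous_on_cross) auto
      then show ?thesis by (simp add: n cong: continuous_on_cong)
    qed
    ultimately have "continuous_on I \<mu>"
      unfolding \<mu>_def[abs_def] L_def by (intro continuous_intros) (use c in auto)
    moreover have "\<mu> s \<noteq> 0" if "s \<in> I" for s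
      using curv[OF that] \<kappa>[OF that] by auto
    ultimately consider "\<forall>s\<in>I. \<mu> s > 0" | "\<forall>s\<in>I. \<mu> s < 0"
      using nonvanishing_constant_sign[OF I(2)] by blast
    then show "\<exists>\<theta>. pseudo_geodesic M N I \<gamma> \<theta> \<and> cos \<theta> \<noteq> 0"
    proof cases
      case 1
      have "principal_normal \<gamma> s = sin \<theta> *\<^sub>R V s + cos \<theta> *\<^sub>R n s" if s: "s \<in> I" for s
      proof -
        have "inverse \<bar>\<mu> s\<bar> * \<mu> s = 1" using bspec[OF 1 s] by simp
        then show ?thesis by (simp add: pn[OF s])
      qed
      then have "pseudo_geodesic M N I \<gamma> \<theta>"
        using \<gamma>M by (simp add: pseudo_geodesic_def V_def T_def n_def)
      with c show ?thesis by blast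
    next
      case 2
      \<comment> \<open>Adding \<open>pi\<close> negates both sine and cosine and thus absorbs the
        sign \<open>- 1\<close>.\<close>
      have "principal_normal \<gamma> s = sin (\<theta> + pi) *\<^sub>R V s + cos (\<theta> + pi) *\<^sub>R n s" if s: "s \<in> I" for s
      proof -
        have "inverse \<bar>\<mu> s\<bar> * \<mu> s = - 1" using bspec[OF 2 s] by simp
        then show ?thesis by (simp add: pn[OF s])
      qed
      then have "pseudo_geodesic M N I \<gamma> (\<theta> + pi)"
        using \<gamma>M by (simp only: pseudo_geodesic_def V_def T_def n_def) blast
      moreover have "cos (\<theta> + pi) \<noteq> 0" using c by simp
      ultimately show ?thesis by blast
    qed
  qed
  then show ?thesis by (simp only: equations cong: ball_cong)
qed

end
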